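(* Let $X\subset\mathbb{CP}^4$ be a quintic 3-fold with small $J$-function $J(Q,q,0)\in K(X)\otimes\mathbb Q(q)[[Q]]$, and let $\mathrm{GV}_d$ $(d\ge1)$ be its genus 0 Gopakumar--Vafa invariants. Assume that $$\frac{1}{1-q}J(Q,q,0)=1+x^2\sum_{d,r\ge1}a(d,r,q^r)\,\mathrm{GV}_d\,Q^{dr}+x^3\sum_{d,r\ge1}b(d,r,q^r)\,\mathrm{GV}_d\,Q^{dr}.$$ Let $[J(Q,q,0)]_{x^\alpha}$ denote the coefficient of $x^\alpha$ in $J(Q,q,0)$. Then $$\sum_{d\ge1}\Big\langle\frac{\Phi_\alpha}{1-qL}\Big\rangle_{0,1,d}Q^d=\begin{cases}-5[J(Q,q,0)]_{x^2}+5[J(Q,q,0)]_{x^3}&\text{if }\alpha=0,\\ 5[J(Q,q,0)]_{x^2}&\text{if }\alpha=1,\\ 0&\text{if }\alpha=2,3.\end{cases}$$ Setting $q=0$, it follows that $$\sum_{d\ge1}\langle1\rangle_{0,1,d}Q^d=\sum_{n=1}^\infty n^2\,\mathrm{GV}^{(-2)}_nQ^n=2875Q+620750Q^2+317232250Q^3+242470013000Q^4+229305888959500Q^5+248249743392434250Q^6+\cdots$$ and $$\sum_{d\ge1}\langle\Phi_1\rangle_{0,1,d}Q^d=\sum_{n=1}^\infty n\,\mathrm{GV}^{(0)}_nQ^n=2875Q+1224250Q^2+951627750Q^3+969872568500Q^4+1146529444452500Q^5+1489498454615043000Q^6+\cdots.$$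
   Context: $K(X)=\mathbb Q[x]/(x^4)$ is the rational K-theory ring of the quintic (the part generated by line bundles restricted from $\mathbb{CP}^4$), where $1-x$ is the class of $\mathcal O(-1)|_X$; it has basis $\Phi_\alpha=x^\alpha$, $\alpha=0,1,2,3$. The pairing $(E,F)\mapsto\chi(E\otimes F)$ (holomorphic Euler characteristic) has matrix, in this basis, $$\begin{pmatrix}0&5&-5&5\\5&-5&5&0\\-5&5&0&0\\5&0&0&0\end{pmatrix},$$ and $\{\Phi^\alpha\}$ is the dual basis. For $d\ge1$, $\langle \Phi L^{k}\rangle_{0,1,d}$ is the genus 0 K-theoretic Gromov--Witten invariant, i.e. the holomorphic Euler characteristic of $\mathcal O^{\rm vir}\otimes {\rm ev}_1^*(\Phi)\otimes L_1^{k}$ over the moduli space of genus 0, degree $d$ stable maps to $X$ with one marked point, where $L_1$ is the cotangent line (orbi)bundle at the marked point; $\langle\Phi\rangle_{0,1,d}$ is the case $k=0$, and $\langle\frac{\Phi}{1-qL}\rangle_{0,1,d}$ is the generating series $\sum_{k\ge 0} q^k\langle\Phi L^k\rangle_{0,1,d}$, a rational function of $q$ regular at $q=0$. The small $J$-function is $$J(Q,q,0)=(1-q)\Phi_0+\sum_{d\ge1}\sum_{\alpha=0}^3\Big\langle\frac{\Phi_\alpha}{1-qL}\Big\rangle_{0,1,d}\Phi^\alpha Q^d .$$ The functions $a,b$ are defined by $$5a(d,r,q)=\frac{dr}{1-q}+\frac{dq}{(1-q)^2},\qquad 5b(d,r,q)=\frac{rd+r^2-d}{1-q}+\frac{d}{(1-q)^2}-\frac{q+q^2}{(1-q)^3}.$$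 The Gopakumar--Vafa invariants are $\mathrm{GV}_n=\sum_{d|n}\frac{\mu(d)}{d^3}\mathrm{GW}_{n/d}$, with $\mathrm{GW}_n$ the genus 0 degree $n$ Gromov--Witten invariants of the quintic. The first values are $\mathrm{GV}_1=2875$, $\mathrm{GV}_2=609250$, $\mathrm{GV}_3=317206375$, $\mathrm{GV}_4=242467530000$, $\mathrm{GV}_5=229305888887625$, $\mathrm{GV}_6=248249742118022000$. For an integer $\gamma$, $\mathrm{GV}^{(\gamma)}_n=\sum_{d|n}d^\gamma\,\mathrm{GV}_d$. *)

theory Defs
  imports "HOL-Computational_Algebra.Computational_Algebra"
begin

section \<open>The ring K(X) and its base changes\<close>

text \<open>
  \<open>R kx\<close> is \<open>R[x]/(x\<^sup>4)\<close>.  Thus \<open>rat kx\<close> is \<open>K(X)\<close>, and with \<open>R\<close> the ring \<open>Q(q)[[Q]]\<close>,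
  i.e. the type \<open>rat poly fract fps\<close>, it is \<open>K(X) \<otimes> Q(q)[[Q]]\<close>: the \<open>fps\<close> variable is the
  Novikov variable \<open>Q\<close>, the \<open>poly\<close> variable is \<open>q\<close>.
\<close>

definition kx_rel :: "'a::comm_ring_1 poly \<Rightarrow> 'a poly \<Rightarrow> bool" where
  "kx_rel p p' \<longleftrightarrow> monom 1 4 dvd p - p'"

lemma equivp_kx_rel: "equivp (kx_rel :: 'a::comm_ring_1 poly \<Rightarrow> 'a poly \<Rightarrow> bool)"
proof (rule equivpI)
  show "reflp (kx_rel :: 'a poly \<Rightarrow> 'a poly \<Rightarrow> bool)" by (auto simp: reflp_def kx_rel_def)
  show "symp (kx_rel :: 'a poly \<Rightarrow> 'a poly \<Rightarrow> bool)"
    unfolding symp_def kx_rel_def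
  proof (intro allI impI)
    fix u v :: "'a poly"
    assume "monom 1 4 dvd u - v"
    then have "monom 1 4 dvd - (u - v)" by (simp only: dvd_minus_iff)
    then show "monom 1 4 dvd v - u" by simp
  qed
  show "transp (kx_rel :: 'a poly \<Rightarrow> 'a poly \<Rightarrow> bool)"
    unfolding transp_def kx_rel_def
  proof (intro allI impI)
    fix u v w :: "'a poly"
    assume "monom 1 4 dvd u - v" "monom 1 4 dvd v - w"
    then have "monom 1 4 dvd (u - v) + (v - w)" by (rule dvd_add)
    then show "monom 1 4 dvd u - w" by simp
  qed
qed

quotient_type (overloaded) 'a kx = "'a::comm_ring_1 poly" / kx_rel
  by (rule equivp_kx_rel)

instantiation kx :: (comm_ring_1) comm_ring_1
begin

lift_definition zero_kx :: "'a kx" is 0 .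
lift_definition one_kx :: "'a kx" is 1 .

lift_definition plus_kx :: "'a kx \<Rightarrow> 'a kx \<Rightarrow> 'a kx" is "(+)"
proof -
  fix p p' r r' :: "'a poly"
  assume "kx_rel p p'" "kx_rel r r'"
  moreover have "(p + r) - (p' + r') = (p - p') + (r - r')"
    by (simp add: algebra_simps)
  ultimately show "kx_rel (p + r) (p' + r')"
    unfolding kx_rel_def by (simp only: dvd_add)
qed

lift_definition minus_kx :: "'a kx \<Rightarrow> 'a kx \<Rightarrow> 'a kx" is "(-)"
proof -
  fix p p' r r' :: "'a poly"
  assume "kx_rel p p'" "kx_rel r r'"
  moreover have "(p - r) - (p' - r') = (p - p') - (r - r')"
    by (simp add: algebra_simps)
  ultimately show "kx_rel (p - r) (p' - r')"
    unfolding kx_rel_def by (simp only: dvd_diff)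
qed

lift_definition uminus_kx :: "'a kx \<Rightarrow> 'a kx" is uminus
proof -
  fix p p' :: "'a poly"
  assume "kx_rel p p'"
  moreover have "- p - - p' = - (p - p')" by simp
  ultimately show "kx_rel (- p) (- p')"
    unfolding kx_rel_def by (simp only: dvd_minus_iff)
qed

lift_definition times_kx :: "'a kx \<Rightarrow> 'a kx \<Rightarrow> 'a kx" is "(*)"
proof -
  fix p p' r r' :: "'a poly"
  assume "kx_rel p p'" "kx_rel r r'"
  moreover have "p * r - p' * r' = (p - p') * r + p' * (r - r')"
    by (simp add: algebra_simps)
  ultimately show "kx_rel (p * r) (p' * r')"
    unfolding kx_rel_def by (simp only: dvd_add dvd_mult dvd_mult2)
qed

instance
proof
  have "\<not> kx_rel (0::'a poly) 1"
  proof
    assume "kx_rel (0::'a poly) 1"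
    then have "monom 1 4 dvd (1::'a poly)"
      by (simp add: kx_rel_def)
    then obtain s :: "'a poly" where "1 = monom 1 4 * s" by (auto elim: dvdE)
    then have "coeff (1::'a poly) 0 = coeff (monom 1 4 * s) 0" by simp
    then show False by (simp add: coeff_monom_mult)
  qed
  then show "(0::'a kx) \<noteq> 1" by transfer
qed (transfer; simp add: kx_rel_def algebra_simps)+

end

lift_definition kx_x :: "'a::comm_ring_1 kx" is "[:0, 1:]" .

lift_definition kx_const :: "'a::comm_ring_1 \<Rightarrow> 'a kx" is "\<lambda>c. [:c:]" .

text \<open>\<open>kx_coeff E i\<close> is the coefficient of \<open>x\<^sup>i\<close> in the basis \<open>1, x, x\<^sup>2, x\<^sup>3\<close>.\<close>

lift_definition kx_coeff :: "'a::comm_ring_1 kx \<Rightarrow> nat \<Rightarrow> 'a"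
  is "\<lambda>p i. if i < 4 then coeff p i else 0"
proof -
  fix p p' :: "'a poly"
  assume "kx_rel p p'"
  then obtain s where "p - p' = monom 1 4 * s" by (auto simp: kx_rel_def elim: dvdE)
  then have "coeff p i - coeff p' i = 0" if "i < 4" for i
    using that by (metis coeff_diff coeff_monom_mult not_less)
  then show "(\<lambda>i. if i < 4 then coeff p i else 0) = (\<lambda>i. if i < 4 then coeff p' i else 0)"
    by auto
qed

section \<open>The pairing and the dual basis\<close>

definition Phi :: "nat \<Rightarrow> rat kx" where
  "Phi \<alpha> = kx_x ^ \<alpha>"

text \<open>
  Holomorphic Euler characteristic on \<open>K(X)\<close>.  By Riemann--Roch
  \<open>\<chi>(X, O(m)) = 5 m (m\<^sup>2 + 5) / 6\<close>; with \<open>O(-1) = 1 - x\<close> the values at \<open>1, x, x\<^sup>2, x\<^sup>3\<close> are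
  \<open>0, 5, -5, 5\<close>.
\<close>

definition euler_char :: "rat kx \<Rightarrow> rat" where
  "euler_char E = 5 * kx_coeff E 1 - 5 * kx_coeff E 2 + 5 * kx_coeff E 3"

definition pairing :: "rat kx \<Rightarrow> rat kx \<Rightarrow> rat" where
  "pairing E F = euler_char (E * F)"

definition dual_Phi :: "nat \<Rightarrow> rat kx" where
  "dual_Phi \<beta> = (THE E. \<forall>\<alpha><4. pairing (Phi \<alpha>) E = (if \<alpha> = \<beta> then 1 else 0))"

lemma kx_x_power: "kx_x ^ n = abs_kx (monom 1 n)"
proof (induction n)
  case 0
  then show ?case by (simp add: one_kx.abs_eq monom_0 one_pCons)
next
  case (Suc n)
  have "[:0, 1:] * monom (1::'a) n = monom 1 (Suc n)"
    by (simp add: monom_Suc)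
  with Suc show ?case by (simp add: kx_x_def times_kx.abs_eq)
qed

lemma kx_coeff_x_power: "kx_coeff (kx_x ^ n) i = (if i = n \<and> i < 4 then 1 else 0)"
  by (simp add: kx_x_power kx_coeff.abs_eq)

lemma pairing_matrix:
  assumes "\<alpha> < 4" "\<beta> < 4"
  shows "pairing (Phi \<alpha>) (Phi \<beta>) =
    [[ 0,  5, -5, 5],
     [ 5, -5,  5, 0],
     [-5,  5,  0, 0],
     [ 5,  0,  0, 0]] ! \<alpha> ! \<beta>"
proof -
  have "\<alpha> \<in> {0, 1, 2, 3}" "\<beta> \<in> {0, 1, 2, 3}" using assms by auto
  then show ?thesis
    by (auto simp: pairing_def euler_char_def Phi_def power_add [symmetric] kx_coeff_x_power
        simp flip: power_Suc power_Suc2)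
qed

section \<open>Q(q) and power series in Q\<close>

definition qvar :: "rat poly fract" where
  "qvar = to_fract [:0, 1:]"

text \<open>\<open>f\<close> is the Taylor expansion at \<open>q = 0\<close> of the rational function \<open>R\<close>, regular there.\<close>

definition expands_to :: "rat poly fract \<Rightarrow> rat fps \<Rightarrow> bool" where
  "expands_to R f \<longleftrightarrow>
     (\<exists>p s. coeff s 0 \<noteq> 0 \<and> R = Fract p s \<and> f = fps_of_poly p / fps_of_poly s)"

text \<open>The power series \<open>\<Sum>n\<ge>1. f n Q\<^sup>n\<close> and \<open>\<Sum>d,r\<ge>1. c d r Q\<^sup>d\<^sup>r\<close>.\<close>

definition Qseries :: "(nat \<Rightarrow> 'a::comm_ring_1) \<Rightarrow> 'a fps" where
  "Qseries f = Abs_fps (\<lambda>n. if n = 0 then 0 else f n)"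

definition Qseries2 :: "(nat \<Rightarrow> nat \<Rightarrow> 'a::comm_ring_1) \<Rightarrow> 'a fps" where
  "Qseries2 c = Qseries (\<lambda>n. \<Sum>(d, r) \<in> {(d, r). d \<ge> 1 \<and> r \<ge> 1 \<and> d * r = n}. c d r)"

text \<open>The base change \<open>K(X) \<rightarrow> K(X) \<otimes> Q(q)[[Q]]\<close>.\<close>

definition kx_base_change :: "rat kx \<Rightarrow> rat poly fract fps kx" where
  "kx_base_change E = (\<Sum>i<4. kx_const (fps_const (of_rat (kx_coeff E i))) * kx_x ^ i)"

section \<open>Correlators and the small J-function\<close>

text \<open>
  Moduli of stable maps are not available here, so the K-theoretic Gromov--Witten invariants
  enter as a parameter: \<open>corr \<Phi> k d\<close> stands for the invariant of \<open>\<Phi> L\<^sup>k\<close> in genus 0 and degree \<open>d\<close> with one marked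
  point (only \<open>d \<ge> 1\<close> is used).  \<open>corr_gen corr \<Phi> d\<close> is the invariant of \<open>\<Phi> / (1 - q L)\<close>, as an
  element of \<open>Q(q)\<close>; it is meaningful when the generating series in \<open>k\<close> is the expansion of
  a rational function, which is then unique.
\<close>

definition corr_gen :: "(rat kx \<Rightarrow> nat \<Rightarrow> nat \<Rightarrow> rat) \<Rightarrow> rat kx \<Rightarrow> nat \<Rightarrow> rat poly fract" where
  "corr_gen corr \<Phi> d = (THE R. expands_to R (Abs_fps (\<lambda>k. corr \<Phi> k d)))"

definition small_J :: "(rat kx \<Rightarrow> nat \<Rightarrow> nat \<Rightarrow> rat) \<Rightarrow> rat poly fract fps kx" where
  "small_J corr =
     kx_const (fps_const (1 - qvar)) * kx_base_change (Phi 0) +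
     (\<Sum>\<alpha><4. kx_const (Qseries (\<lambda>d. corr_gen corr (Phi \<alpha>) d)) * kx_base_change (dual_Phi \<alpha>))"

definition a_fun :: "nat \<Rightarrow> nat \<Rightarrow> 'a::field_char_0 \<Rightarrow> 'a" where
  "a_fun d r q = (of_nat d * of_nat r / (1 - q) + of_nat d * q / (1 - q)^2) / 5"

definition b_fun :: "nat \<Rightarrow> nat \<Rightarrow> 'a::field_char_0 \<Rightarrow> 'a" where
  "b_fun d r q =
     ((of_nat r * of_nat d + of_nat r ^ 2 - of_nat d) / (1 - q) + of_nat d / (1 - q)^2
        - (q + q^2) / (1 - q)^3) / 5"

section \<open>Gopakumar--Vafa invariants\<close>

text \<open>Likewise \<open>GW n\<close> stands for the genus 0 degree \<open>n\<close> Gromov--Witten invariant.\<close>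

definition moebius :: "nat \<Rightarrow> int" where
  "moebius n = (if squarefree n then (-1) ^ card (prime_factors n) else 0)"

definition GV :: "(nat \<Rightarrow> rat) \<Rightarrow> nat \<Rightarrow> rat" where
  "GV GW n = (\<Sum>d | d dvd n. of_int (moebius d) / of_nat d ^ 3 * GW (n div d))"

definition GV_sum :: "(nat \<Rightarrow> rat) \<Rightarrow> int \<Rightarrow> nat \<Rightarrow> rat" where
  "GV_sum GW \<gamma> n = (\<Sum>d | d dvd n. of_nat d powi \<gamma> * GV GW d)"

end

theory Submission
  imports Defs
begin

text \<open>
  The theorem is a change of basis followed by a specialisation at \<open>q = 0\<close>.

  Inverting the matrix of the pairing gives the dual basis
  \<open>\<Phi>\<^sup>0 = x\<^sup>3/5\<close>, \<open>\<Phi>\<^sup>1 = (x\<^sup>2 + x\<^sup>3)/5\<close>, \<open>\<Phi>\<^sup>2 = (x + x\<^sup>2)/5\<close>, \<open>\<Phi>\<^sup>3 = (1 + x - x\<^sup>3)/5\<close>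
  (\<open>kx_coeff_dual_Phi\<close>).  Writing \<open>S\<^sub>\<alpha>\<close> for the series of the invariants of \<open>\<Phi>\<^sub>\<alpha>/(1 - qL)\<close>, the
  coefficients of \<open>1, x, x\<^sup>2, x\<^sup>3\<close> in \<open>J\<close> are therefore
  \<open>1 - q + S\<^sub>3/5\<close>, \<open>(S\<^sub>2 + S\<^sub>3)/5\<close>, \<open>(S\<^sub>1 + S\<^sub>2)/5\<close> and \<open>(S\<^sub>0 + S\<^sub>1 - S\<^sub>3)/5\<close> (\<open>kx_coeff_small_J\<close>).
  The formula assumed for \<open>J\<close> has constant term \<open>1 - q\<close> and no term in \<open>x\<close>, which forces
  \<open>S\<^sub>3 = S\<^sub>2 = 0\<close>; the other two coefficients then determine \<open>S\<^sub>1\<close> and \<open>S\<^sub>0\<close>.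

  For the specialisation, an element of \<open>Q(q)\<close> that is regular at \<open>q = 0\<close> has a value there
  (\<open>has_value0\<close>), compatible with the field operations.  For \<open>S\<^sub>\<alpha>\<close> this value is the
  series of the invariants with \<open>k = 0\<close>.  Since \<open>r \<ge> 1\<close>, the argument \<open>q\<^sup>r\<close> vanishes at
  \<open>q = 0\<close>, so \<open>5 a\<close> and \<open>5 b\<close> become \<open>d r\<close> and \<open>r d + r\<^sup>2\<close>; the factor
  \<open>1 - q\<close> relating the assumed formula to \<open>J\<close> becomes 1.  Hence \<open>S\<^sub>1\<close>
  becomes the sum of \<open>d r GV\<^sub>d Q\<^sup>d\<^sup>r\<close> and \<open>S\<^sub>0\<close> the sum of \<open>r\<^sup>2 GV\<^sub>d Q\<^sup>d\<^sup>r\<close>; collecting the terms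
  with \<open>d r = n\<close> gives the divisor sums.
\<close>

section \<open>Coefficients in K(X)\<close>

lemma kx_eqI:
  assumes "\<And>i. i < 4 \<Longrightarrow> kx_coeff E i = kx_coeff F i"
  shows "E = F"
  using assms
proof transfer
  fix p r :: "'a poly"
  assume eq: "\<And>i. i < 4 \<Longrightarrow> (if i < 4 then coeff p i else 0) = (if i < 4 then coeff r i else 0)"
  have "p - r = monom 1 4 * poly_shift 4 (p - r)"
    using eq by (intro poly_eqI) (auto simp: coeff_monom_mult coeff_poly_shift)
  then show "kx_rel p r"
    unfolding kx_rel_def by (metis dvd_triv_left)
qed

lemma kx_coeff_add: "kx_coeff (E + F) i = kx_coeff E i + kx_coeff F i"
  by transfer auto

lemma kx_coeff_0: "kx_coeff 0 i = 0"
  by transfer auto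

lemma kx_coeff_sum: "kx_coeff (\<Sum>j\<in>A. E j) i = (\<Sum>j\<in>A. kx_coeff (E j) i)"
  by (induction A rule: infinite_finite_induct) (simp_all add: kx_coeff_add kx_coeff_0)

lemma kx_coeff_const_mult: "kx_coeff (kx_const c * E) i = c * kx_coeff E i"
  by transfer auto

lemma kx_coeff_const: "kx_coeff (kx_const c) i = (if i = 0 then c else 0)"
  by transfer (auto simp: coeff_pCons split: nat.splits)

lemma kx_coeff_1: "kx_coeff 1 i = (if i = 0 then 1 else 0)"
  by transfer auto

lemma kx_coeff_x_power_mult:
  "kx_coeff (kx_x ^ n * E) i = (if n \<le> i \<and> i < 4 then kx_coeff E (i - n) else 0)"
  unfolding kx_x_power by transfer (auto simp: coeff_monom_mult)

lemma kx_coeff_base_change: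
  assumes "i < 4"
  shows "kx_coeff (kx_base_change E) i = fps_const (of_rat (kx_coeff E i))"
proof -
  have "kx_coeff (kx_base_change E) i =
      (\<Sum>j<4. fps_const (of_rat (kx_coeff E j)) * (if i = j then 1 else 0))"
    using assms
    by (simp add: kx_base_change_def kx_coeff_sum kx_coeff_const_mult kx_coeff_x_power)
  also have "\<dots> = fps_const (of_rat (kx_coeff E i))"
    using assms by (simp add: if_distrib sum.delta cong: if_cong)
  finally show ?thesis .
qed

section \<open>The dual basis and the coefficients of the J-function\<close>

lemma pairing_Phi:
  "pairing (Phi \<alpha>) E =
     5 * (if \<alpha> \<le> 1 then kx_coeff E (1 - \<alpha>) else 0) -
     5 * (if \<alpha> \<le> 2 then kx_coeff E (2 - \<alpha>) else 0) +
     5 * (if \<alpha> \<le> 3 then kx_coeff E (3 - \<alpha>) else 0)"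
  by (simp add: pairing_def euler_char_def Phi_def kx_coeff_x_power_mult)

text \<open>Row \<open>\<beta>\<close> of the inverse of the matrix of the pairing.\<close>

definition dual_coeffs :: "nat \<Rightarrow> rat list" where
  "dual_coeffs \<beta> = [[0, 0, 0, 1/5], [0, 0, 1/5, 1/5], [0, 1/5, 1/5, 0], [1/5, 1/5, 0, -1/5]] ! \<beta>"

lemma all_less_4: "(\<forall>i<4. P i) \<longleftrightarrow> P 0 \<and> P 1 \<and> P 2 \<and> P (3::nat)"
  by (auto simp: numeral_eq_Suc less_Suc_eq)

text \<open>
  The pairing matrix is triangular along the antidiagonal, so \<open>\<alpha> = 3, 2, 1, 0\<close> determine the
  coefficients of \<open>E\<close> one after the other.
\<close>

lemma dual_basis_condition:
  assumes "\<beta> < 4"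
  shows "(\<forall>\<alpha><4. pairing (Phi \<alpha>) E = (if \<alpha> = \<beta> then 1 else 0)) \<longleftrightarrow>
    (\<forall>i<4. kx_coeff E i = dual_coeffs \<beta> ! i)"
proof -
  have "\<beta> \<in> {0, 1, 2, 3}" using assms by auto
  then show ?thesis
    unfolding all_less_4 pairing_Phi
    by (elim insertE emptyE; hypsubst) (simp_all add: dual_coeffs_def, linarith+)
qed

lemma kx_coeff_dual_Phi:
  assumes "\<beta> < 4" "i < 4"
  shows "kx_coeff (dual_Phi \<beta>) i = dual_coeffs \<beta> ! i"
proof -
  define E where "E = (\<Sum>j<4. kx_const (dual_coeffs \<beta> ! j) * kx_x ^ j)"
  have coeff_E: "kx_coeff E k = dual_coeffs \<beta> ! k" if "k < 4" for k
  proof -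
    have "kx_coeff E k = (\<Sum>j<4. dual_coeffs \<beta> ! j * (if k = j then 1 else 0))"
      using that by (simp add: E_def kx_coeff_sum kx_coeff_const_mult kx_coeff_x_power)
    also have "\<dots> = dual_coeffs \<beta> ! k"
      using that by (simp add: if_distrib sum.delta cong: if_cong)
    finally show ?thesis .
  qed
  have "dual_Phi \<beta> = E"
    unfolding dual_Phi_def dual_basis_condition[OF assms(1)]
    by (rule the_equality) (auto intro: kx_eqI simp: coeff_E)
  then show ?thesis
    using coeff_E assms(2) by simp
qed

lemma kx_coeff_small_J:
  fixes corr
  defines "S \<equiv> \<lambda>\<alpha>. Qseries (corr_gen corr (Phi \<alpha>))"
  defines "c \<equiv> fps_const (1/5)"
  shows "kx_coeff (small_J corr) 0 = fps_const (1 - qvar) + c * S 3"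
    and "kx_coeff (small_J corr) 1 = c * (S 2 + S 3)"
    and "kx_coeff (small_J corr) 2 = c * (S 1 + S 2)"
    and "kx_coeff (small_J corr) 3 = c * (S 0 + S 1 - S 3)"
proof -
  have J: "kx_coeff (small_J corr) i =
      fps_const (1 - qvar) * fps_const (of_rat (if i = 0 then 1 else 0)) +
      (\<Sum>\<alpha><4. S \<alpha> * fps_const (of_rat (dual_coeffs \<alpha> ! i)))" if "i < 4" for i
    using that
    by (simp add: small_J_def S_def kx_coeff_add kx_coeff_sum kx_coeff_const_mult
        kx_coeff_base_change kx_coeff_dual_Phi Phi_def kx_coeff_1)
  have sum4: "(\<Sum>\<alpha><4. f \<alpha>) = f 0 + f 1 + f 2 + f 3" for f :: "nat \<Rightarrow> rat poly fract fps"
    by (simp add: numeral_eq_Suc)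
  have fifth: "of_rat (1/5) = (1/5 :: rat poly fract)"
    by (simp add: of_rat_divide)
  have minus: "fps_const (- (1/5)) = - c"
    by (simp add: c_def)
  show "kx_coeff (small_J corr) 0 = fps_const (1 - qvar) + c * S 3"
    "kx_coeff (small_J corr) 1 = c * (S 2 + S 3)"
    "kx_coeff (small_J corr) 2 = c * (S 1 + S 2)"
    "kx_coeff (small_J corr) 3 = c * (S 0 + S 1 - S 3)"
    by (simp_all add: J sum4 dual_coeffs_def fifth of_rat_minus minus algebra_simps
        flip: c_def fps_const_neg)
qed

section \<open>Values of rational functions at q = 0\<close>

text \<open>
  Regularity at \<open>q = 0\<close> together with the value there.  A relation is used because
  the value has no meaning at a pole.
\<close>

definition has_value0 :: "rat poly fract \<Rightarrow> rat \<Rightarrow> bool" where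
  "has_value0 R c \<longleftrightarrow> (\<exists>p s. coeff s 0 \<noteq> 0 \<and> R = Fract p s \<and> coeff p 0 = c * coeff s 0)"

lemma has_value0_unique:
  assumes "has_value0 R c" "has_value0 R c'"
  shows "c = c'"
proof -
  from assms obtain p s p' s' where
    s: "coeff s 0 \<noteq> 0" "R = Fract p s" "coeff p 0 = c * coeff s 0" and
    s': "coeff s' 0 \<noteq> 0" "R = Fract p' s'" "coeff p' 0 = c' * coeff s' 0"
    unfolding has_value0_def by blast
  from s s' have "s \<noteq> 0" "s' \<noteq> 0" by auto
  with s(2) s'(2) have "p * s' = p' * s" by (simp add: eq_fract)
  then have "coeff (p * s') 0 = coeff (p' * s) 0" by simp
  with s s' show ?thesis by (simp add: coeff_mult)
qed

lemma has_value0_to_fract: "has_value0 (to_fract p) (coeff p 0)"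
  unfolding has_value0_def
  by (rule exI[of _ p], rule exI[of _ 1]) (simp add: to_fract_def)

lemma has_value0_0: "has_value0 0 0"
  using has_value0_to_fract[of 0] by simp

lemma has_value0_1: "has_value0 1 1"
  using has_value0_to_fract[of 1] by simp

lemma has_value0_qvar: "has_value0 qvar 0"
  using has_value0_to_fract[of "[:0, 1:]"] by (simp add: qvar_def)

lemma has_value0_uminus:
  assumes "has_value0 R c"
  shows "has_value0 (- R) (- c)"
proof -
  from assms obtain p s where
    s: "coeff s 0 \<noteq> 0" "R = Fract p s" "coeff p 0 = c * coeff s 0"
    unfolding has_value0_def by blast
  then show ?thesis
    unfolding has_value0_def by (intro exI[of _ "- p"] exI[of _ s]) auto
qed

lemma has_value0_add:
  assumes "has_value0 R c" "has_value0 R' c'"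
  shows "has_value0 (R + R') (c + c')"
proof -
  from assms obtain p s p' s' where
    s: "coeff s 0 \<noteq> 0" "R = Fract p s" "coeff p 0 = c * coeff s 0" and
    s': "coeff s' 0 \<noteq> 0" "R' = Fract p' s'" "coeff p' 0 = c' * coeff s' 0"
    unfolding has_value0_def by blast
  from s s' have "s \<noteq> 0" "s' \<noteq> 0" by auto
  with s s' show ?thesis
    unfolding has_value0_def
    by (intro exI[of _ "p * s' + p' * s"] exI[of _ "s * s'"])
       (simp add: coeff_mult algebra_simps)
qed

lemma has_value0_diff:
  "has_value0 R c \<Longrightarrow> has_value0 R' c' \<Longrightarrow> has_value0 (R - R') (c - c')"
  using has_value0_add[OF _ has_value0_uminus] by fastforce

lemma has_value0_mult:
  assumes "has_value0 R c" "has_value0 R' c'"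
  shows "has_value0 (R * R') (c * c')"
proof -
  from assms obtain p s p' s' where
    s: "coeff s 0 \<noteq> 0" "R = Fract p s" "coeff p 0 = c * coeff s 0" and
    s': "coeff s' 0 \<noteq> 0" "R' = Fract p' s'" "coeff p' 0 = c' * coeff s' 0"
    unfolding has_value0_def by blast
  then show ?thesis
    unfolding has_value0_def
    by (intro exI[of _ "p * p'"] exI[of _ "s * s'"])
       (simp add: coeff_mult algebra_simps)
qed

lemma has_value0_divide:
  assumes "has_value0 R c" "has_value0 R' c'" "c' \<noteq> 0"
  shows "has_value0 (R / R') (c / c')"
proof -
  from assms(2) obtain p s where
    s: "coeff s 0 \<noteq> 0" "R' = Fract p s" "coeff p 0 = c' * coeff s 0"
    unfolding has_value0_def by blast
  then have "has_value0 (inverse R') (1 / c')"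
    unfolding has_value0_def using assms(3)
    by (intro exI[of _ s] exI[of _ p]) simp
  from has_value0_mult[OF assms(1) this] show ?thesis
    by (simp add: divide_inverse)
qed

lemma has_value0_power: "has_value0 R c \<Longrightarrow> has_value0 (R ^ n) (c ^ n)"
  by (induction n) (simp_all add: has_value0_1 has_value0_mult)

lemma has_value0_of_nat: "has_value0 (of_nat n) (of_nat n)"
  by (induction n) (simp_all add: has_value0_0 has_value0_1 has_value0_add)

lemma has_value0_numeral: "has_value0 (numeral n) (numeral n)"
  using has_value0_of_nat[of "numeral n"] by simp

lemma has_value0_of_int: "has_value0 (of_int z) (of_int z)"
  by (cases z) (simp_all only: of_int_of_nat_eq of_int_minus has_value0_of_nat has_value0_uminus)

lemma has_value0_of_rat: "has_value0 (of_rat c) c"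
proof (cases c)
  case (Fract u v)
  then show ?thesis
    using has_value0_divide[OF has_value0_of_int[of u] has_value0_of_int[of v]]
    by (simp add: of_rat_divide Fract_of_int_quotient)
qed

lemma has_value0_sum:
  "(\<And>i. i \<in> A \<Longrightarrow> has_value0 (f i) (g i)) \<Longrightarrow> has_value0 (\<Sum>i\<in>A. f i) (\<Sum>i\<in>A. g i)"
  by (induction A rule: infinite_finite_induct) (simp_all add: has_value0_0 has_value0_add)

lemmas has_value0_intros =
  has_value0_add has_value0_diff has_value0_mult has_value0_divide has_value0_power
  has_value0_of_nat has_value0_numeral has_value0_1 has_value0_qvar has_value0_of_rat

lemma has_value0_a_fun:
  assumes "r \<ge> 1"
  shows "has_value0 (a_fun d r (qvar ^ r)) (of_nat d * of_nat r / 5)"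
proof -
  have 0: "0 ^ r = (0 :: rat)" using assms by simp
  have "has_value0 (a_fun d r (qvar ^ r)) (a_fun d r (0 ^ r))"
    unfolding a_fun_def by (intro has_value0_intros) (simp_all add: 0)
  then show ?thesis by (simp add: a_fun_def 0)
qed

lemma has_value0_b_fun:
  assumes "r \<ge> 1"
  shows "has_value0 (b_fun d r (qvar ^ r)) ((of_nat r * of_nat d + of_nat r ^ 2) / 5)"
proof -
  have 0: "0 ^ r = (0 :: rat)" using assms by simp
  have "has_value0 (b_fun d r (qvar ^ r)) (b_fun d r (0 ^ r))"
    unfolding b_fun_def by (intro has_value0_intros) (simp_all add: 0)
  then show ?thesis by (simp add: b_fun_def 0)
qed

section \<open>The generating series of correlators\<close>

lemma fps_of_poly_divide_mult:
  fixes p s :: "'a::field poly"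
  assumes "coeff s 0 \<noteq> 0"
  shows "fps_of_poly p / fps_of_poly s * fps_of_poly s = fps_of_poly p"
  using assms by (simp add: fps_divide_unit inverse_mult_eq_1 mult.assoc)

text \<open>
  Clearing denominators in \<open>Q[[q]]\<close> gives an identity of polynomials, which is equality of
  the two fractions.
\<close>

lemma expands_to_unique:
  assumes "expands_to R f" "expands_to R' f"
  shows "R = R'"
proof -
  from assms obtain p s p' s' where
    s: "coeff s 0 \<noteq> 0" "R = Fract p s" "f = fps_of_poly p / fps_of_poly s" and
    s': "coeff s' 0 \<noteq> 0" "R' = Fract p' s'" "f = fps_of_poly p' / fps_of_poly s'"
    unfolding expands_to_def by blast
  have "f * fps_of_poly s = fps_of_poly p" "f * fps_of_poly s' = fps_of_poly p'"
    using fps_of_poly_divide_mult s(1,3) s'(1,3) by metis+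
  then have "fps_of_poly p * fps_of_poly s' = fps_of_poly p' * fps_of_poly s"
    by (metis mult.assoc mult.commute)
  then have "p * s' = p' * s"
    by (simp flip: fps_of_poly_mult)
  moreover have "s \<noteq> 0" "s' \<noteq> 0" using s s' by auto
  ultimately show ?thesis using s s' by (simp add: eq_fract)
qed

lemma expands_to_has_value0:
  assumes "expands_to R f"
  shows "has_value0 R (f $ 0)"
proof -
  from assms obtain p s where
    s: "coeff s 0 \<noteq> 0" "R = Fract p s" "f = fps_of_poly p / fps_of_poly s"
    unfolding expands_to_def by blast
  have "f * fps_of_poly s = fps_of_poly p"
    using fps_of_poly_divide_mult s by metis
  then have "(f * fps_of_poly s) $ 0 = fps_of_poly p $ 0" by simp
  with s show ?thesis
    unfolding has_value0_def by (intro exI[of _ p] exI[of _ s]) auto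
qed

text \<open>
  This turns statements about the rational function \<open>corr_gen\<close>, defined by a unique
  description, into statements about the invariants themselves.
\<close>

lemma has_value0_corr_gen:
  assumes "\<exists>R. expands_to R (Abs_fps (\<lambda>k. corr E k d))"
  shows "has_value0 (corr_gen corr E d) (corr E 0 d)"
proof -
  have "\<exists>!R. expands_to R (Abs_fps (\<lambda>k. corr E k d))"
    using assms expands_to_unique by blast
  from theI'[OF this] have "expands_to (corr_gen corr E d) (Abs_fps (\<lambda>k. corr E k d))"
    unfolding corr_gen_def .
  from expands_to_has_value0[OF this] show ?thesis by simp
qed

section \<open>Divisor sums and truncations\<close>

lemma sum_factor_pairs:
  fixes n :: nat
  assumes "n \<ge> 1"
  shows "(\<Sum>(d, r) \<in> {(d, r). d \<ge> 1 \<and> r \<ge> 1 \<and> d * r = n}. f d r) = (\<Sum>d | d dvd n. f d (n div d))"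
  using assms
  by (intro sum.reindex_bij_witness[of _ "\<lambda>d. (d, n div d)" fst]) (auto elim!: dvdE)

lemma Qseries_nth: "Qseries f $ n = (if n = 0 then 0 else f n)"
  by (simp add: Qseries_def)

lemma Qseries2_nth:
  assumes "n \<ge> 1"
  shows "Qseries2 c $ n = (\<Sum>d | d dvd n. c d (n div d))"
  using assms sum_factor_pairs[OF assms, of c] by (simp add: Qseries2_def Qseries_nth)

text \<open>
  The next two lemmas evaluate the coefficients of \<open>Q\<^sup>n\<close> left at \<open>q = 0\<close>: with \<open>r = n / d\<close>, the
  weight \<open>d r\<close> is the constant \<open>n\<close>, and \<open>r\<^sup>2\<close> is \<open>n\<^sup>2\<close> times \<open>d\<close> to the power \<open>-2\<close>.
\<close>

lemma GV_sum_0_eq: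
  "(\<Sum>d | d dvd n. of_nat d * of_nat (n div d) * GV GW d) = of_nat n * GV_sum GW 0 n"
proof -
  have "of_nat d * of_nat (n div d) = (of_nat n :: rat)" if "d dvd n" for d
    using that by (metis dvd_mult_div_cancel of_nat_mult)
  then show ?thesis by (simp add: GV_sum_def sum_distrib_left)
qed

lemma GV_sum_minus_2_eq:
  assumes "n \<ge> 1"
  shows "(\<Sum>d | d dvd n. of_nat (n div d) ^ 2 * GV GW d) = of_nat n ^ 2 * GV_sum GW (- 2) n"
proof -
  have "of_nat (n div d) ^ 2 * g = of_nat n ^ 2 * (of_nat d powi (- 2) * g)"
    if "d dvd n" for d and g :: rat
  proof -
    have "(of_nat n :: rat) = of_nat d * of_nat (n div d)" "d \<noteq> 0"
      using that assms by (auto simp flip: of_nat_mult)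
    then show ?thesis
      by (simp add: power_int_minus power_mult_distrib field_simps)
  qed
  then show ?thesis unfolding GV_sum_def sum_distrib_left by (intro sum.cong) auto
qed

lemma divisors_up_to_6:
  "{d. d dvd (1::nat)} = {1}" "{d. d dvd (2::nat)} = {1, 2}" "{d. d dvd (3::nat)} = {1, 3}"
  "{d. d dvd (4::nat)} = {1, 2, 4}" "{d. d dvd (5::nat)} = {1, 5}"
  "{d. d dvd (6::nat)} = {1, 2, 3, 6}"
proof -
  have divisors: "{d. d dvd n} = set (filter (\<lambda>d. d dvd n) [1..<Suc n])" if "n > 0" for n :: nat
    using that by (auto dest: dvd_imp_le intro: Suc_leI dvd_pos_nat)
  show "{d. d dvd (1::nat)} = {1}" "{d. d dvd (2::nat)} = {1, 2}" "{d. d dvd (3::nat)} = {1, 3}"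
    "{d. d dvd (4::nat)} = {1, 2, 4}" "{d. d dvd (5::nat)} = {1, 5}"
    "{d. d dvd (6::nat)} = {1, 2, 3, 6}"
    by (subst divisors; simp add: upt_rec del: One_nat_def)+
qed

lemma fps_cutoff_7_Qseries:
  fixes f :: "nat \<Rightarrow> 'a::comm_ring_1"
  shows "fps_cutoff 7 (Qseries f) =
    fps_const (f 1) * fps_X + fps_const (f 2) * fps_X ^ 2 + fps_const (f 3) * fps_X ^ 3
      + fps_const (f 4) * fps_X ^ 4 + fps_const (f 5) * fps_X ^ 5 + fps_const (f 6) * fps_X ^ 6"
proof (rule fps_ext)
  fix n :: nat
  have "n \<in> {0, 1, 2, 3, 4, 5, 6} \<or> n \<ge> 7" by auto
  then show "fps_cutoff 7 (Qseries f) $ n =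
    (fps_const (f 1) * fps_X + fps_const (f 2) * fps_X ^ 2 + fps_const (f 3) * fps_X ^ 3
      + fps_const (f 4) * fps_X ^ 4 + fps_const (f 5) * fps_X ^ 5 + fps_const (f 6) * fps_X ^ 6) $ n"
    by (auto simp: Qseries_nth fps_X_power_nth fps_X_nth)
qed


theorem corollary1p3:
  fixes corr :: "rat kx \<Rightarrow> nat \<Rightarrow> nat \<Rightarrow> rat"
    and GW :: "nat \<Rightarrow> rat"
  assumes corr_add: "\<And>E F k d. d \<ge> 1 \<Longrightarrow> corr (E + F) k d = corr E k d + corr F k d"
    and corr_scale: "\<And>c E k d. d \<ge> 1 \<Longrightarrow> corr (kx_const c * E) k d = c * corr E k d"
    and corr_rational: "\<And>E d. d \<ge> 1 \<Longrightarrow> \<exists>R. expands_to R (Abs_fps (\<lambda>k. corr E k d))"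
    and GV_values: "GV GW 1 = 2875" "GV GW 2 = 609250" "GV GW 3 = 317206375"
      "GV GW 4 = 242467530000" "GV GW 5 = 229305888887625" "GV GW 6 = 248249742118022000"
    and J_formula:
      "kx_const (fps_const (1 / (1 - qvar))) * small_J corr =
         1 + kx_x ^ 2 * kx_const (Qseries2 (\<lambda>d r. a_fun d r (qvar ^ r) * of_rat (GV GW d)))
           + kx_x ^ 3 * kx_const (Qseries2 (\<lambda>d r. b_fun d r (qvar ^ r) * of_rat (GV GW d)))"
  shows "(\<forall>\<alpha><4. Qseries (\<lambda>d. corr_gen corr (Phi \<alpha>) d) =
            (if \<alpha> = 0 then - 5 * kx_coeff (small_J corr) 2 + 5 * kx_coeff (small_J corr) 3
             else if \<alpha> = 1 then 5 * kx_coeff (small_J corr) 2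
             else 0)) \<and>
         Qseries (\<lambda>d. corr 1 0 d) = Qseries (\<lambda>n. of_nat n ^ 2 * GV_sum GW (- 2) n) \<and>
         fps_cutoff 7 (Qseries (\<lambda>d. corr 1 0 d)) =
           2875 * fps_X + 620750 * fps_X ^ 2 + 317232250 * fps_X ^ 3
             + 242470013000 * fps_X ^ 4 + 229305888959500 * fps_X ^ 5
             + 248249743392434250 * fps_X ^ 6 \<and>
         Qseries (\<lambda>d. corr (Phi 1) 0 d) = Qseries (\<lambda>n. of_nat n * GV_sum GW 0 n) \<and>
         fps_cutoff 7 (Qseries (\<lambda>d. corr (Phi 1) 0 d)) =
           2875 * fps_X + 1224250 * fps_X ^ 2 + 951627750 * fps_X ^ 3
             + 969872568500 * fps_X ^ 4 + 1146529444452500 * fps_X ^ 5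
             + 1489498454615043000 * fps_X ^ 6"
proof -
  define S where "S \<alpha> = Qseries (corr_gen corr (Phi \<alpha>))" for \<alpha>
  define J where "J i = kx_coeff (small_J corr) i" for i
  \<comment> \<open>It takes the value 1 at \<open>q = 0\<close>.\<close>
  have q: "1 - qvar \<noteq> 0"
    using has_value0_diff[OF has_value0_1 has_value0_qvar] has_value0_unique[OF has_value0_0]
    by fastforce
  have five: "5 * fps_const (1/5) = (1 :: rat poly fract fps)"
    by (simp add: numeral_fps_const)
  have coeffs: "fps_const (1 / (1 - qvar)) * J i =
      (if i = 0 then 1 else 0) +
      (if i = 2 then Qseries2 (\<lambda>d r. a_fun d r (qvar ^ r) * of_rat (GV GW d)) else 0) +
      (if i = 3 then Qseries2 (\<lambda>d r. b_fun d r (qvar ^ r) * of_rat (GV GW d)) else 0)"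
    if "i < 4" for i
    using arg_cong[OF J_formula, of "\<lambda>E. kx_coeff E i"] that
    by (auto simp: J_def kx_coeff_add kx_coeff_const_mult kx_coeff_x_power_mult kx_coeff_const
        kx_coeff_1)
  have J_eq: "J i = fps_const (1 - qvar) * F"
    if "fps_const (1 / (1 - qvar)) * J i = F" for i F
    using q by (simp flip: that mult.assoc)
  note J_S = kx_coeff_small_J[of corr, folded S_def J_def]

  have J0: "J 0 = fps_const (1 - qvar)" and J1: "J 1 = 0"
    using J_eq[OF coeffs[of 0]] J_eq[OF coeffs[of 1]] by simp_all
  have S3: "S 3 = 0"
    using J_S(1) J0 by simp
  have S2: "S 2 = 0"
    using J_S(2) J1 S3 by simp
  \<comment> \<open>Multiplying the coefficients of \<open>x\<^sup>2\<close> and \<open>x\<^sup>3\<close> by 5 clears the denominators of the dual basis.\<close>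
  have S1: "S 1 = 5 * J 2"
    using S2 five by (simp add: J_S(3) flip: mult.assoc)
  have S0: "S 0 = - 5 * J 2 + 5 * J 3"
  proof -
    have "5 * J 3 = S 0 + S 1"
      using S3 five by (simp add: J_S(4) flip: mult.assoc)
    with S1 show ?thesis by simp
  qed

  have S1_nth: "S 1 $ n = 5 * J 2 $ n" and S0_nth: "S 0 $ n = 5 * J 3 $ n - 5 * J 2 $ n" for n
    unfolding S1 S0 by (simp_all add: numeral_fps_const flip: fps_const_neg)

  have value_J2: "has_value0 (J 2 $ n) (\<Sum>d | d dvd n. of_nat d * of_nat (n div d) / 5 * GV GW d)"
    if n: "n \<ge> 1" for n
  proof -
    have r: "n div d \<ge> 1" if "d dvd n" for d
      using that n by (auto elim!: dvdE)
    have "has_value0 ((1 - qvar) *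
        (\<Sum>d | d dvd n. a_fun d (n div d) (qvar ^ (n div d)) * of_rat (GV GW d)))
        ((1 - 0) * (\<Sum>d | d dvd n. of_nat d * of_nat (n div d) / 5 * GV GW d))"
      by (intro has_value0_sum has_value0_a_fun has_value0_intros) (use r in auto)
    then show ?thesis
      using J_eq[OF coeffs[of 2]] n by (simp add: Qseries2_nth)
  qed
  have value_J3: "has_value0 (J 3 $ n)
      (\<Sum>d | d dvd n. (of_nat (n div d) * of_nat d + of_nat (n div d) ^ 2) / 5 * GV GW d)"
    if n: "n \<ge> 1" for n
  proof -
    have r: "n div d \<ge> 1" if "d dvd n" for d
      using that n by (auto elim!: dvdE)
    have "has_value0 ((1 - qvar) *
        (\<Sum>d | d dvd n. b_fun d (n div d) (qvar ^ (n div d)) * of_rat (GV GW d)))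
        ((1 - 0) *
        (\<Sum>d | d dvd n. (of_nat (n div d) * of_nat d + of_nat (n div d) ^ 2) / 5 * GV GW d))"
      by (intro has_value0_sum has_value0_b_fun has_value0_intros) (use r in auto)
    then show ?thesis
      using J_eq[OF coeffs[of 3]] n by (simp add: Qseries2_nth)
  qed
  have value_S: "has_value0 (S \<alpha> $ n) (corr (Phi \<alpha>) 0 n)" if "n \<ge> 1" for \<alpha> n
    using has_value0_corr_gen[of corr, OF corr_rational[OF that]] that by (simp add: S_def Qseries_nth)

  have corr_Phi1: "corr (Phi 1) 0 n = of_nat n * GV_sum GW 0 n" if n: "n \<ge> 1" for n
  proof -
    have "has_value0 (S 1 $ n)
        (5 * (\<Sum>d | d dvd n. of_nat d * of_nat (n div d) / 5 * GV GW d))"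
      unfolding S1_nth by (rule has_value0_mult[OF has_value0_numeral value_J2[OF n]])
    from has_value0_unique[OF value_S[OF n] this] show ?thesis
      by (simp add: sum_distrib_left GV_sum_0_eq)
  qed
  have corr_1: "corr 1 0 n = of_nat n ^ 2 * GV_sum GW (- 2) n" if n: "n \<ge> 1" for n
  proof -
    \<comment> \<open>The terms \<open>d r\<close> of \<open>5 a\<close> and \<open>5 b\<close> cancel and leave \<open>r\<^sup>2\<close>.\<close>
    have "has_value0 (S 0 $ n)
        (5 * (\<Sum>d | d dvd n. (of_nat (n div d) * of_nat d + of_nat (n div d) ^ 2) / 5 * GV GW d)
         - 5 * (\<Sum>d | d dvd n. of_nat d * of_nat (n div d) / 5 * GV GW d))"
      unfolding S0_nth
      by (intro has_value0_diff has_value0_mult has_value0_numeral value_J3 value_J2 n)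
    also have "5 * (\<Sum>d | d dvd n. (of_nat (n div d) * of_nat d + of_nat (n div d) ^ 2) / 5 * GV GW d)
         - 5 * (\<Sum>d | d dvd n. of_nat d * of_nat (n div d) / 5 * GV GW d)
       = (\<Sum>d | d dvd n. of_nat (n div d) ^ 2 * GV GW d)"
      unfolding sum_distrib_left sum_subtractf[symmetric]
      by (intro sum.cong refl) (simp add: algebra_simps add_divide_distrib)
    finally have "has_value0 (S 0 $ n) (of_nat n ^ 2 * GV_sum GW (- 2) n)"
      using GV_sum_minus_2_eq[OF n] by simp
    from has_value0_unique[OF value_S[OF n] this] show ?thesis
      by (simp add: Phi_def)
  qed

  have "\<forall>\<alpha><4. S \<alpha> = (if \<alpha> = 0 then - 5 * J 2 + 5 * J 3 else if \<alpha> = 1 then 5 * J 2 else 0)"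
    unfolding all_less_4 using S0 S1 S2 S3 by simp
  moreover have "Qseries (\<lambda>d. corr 1 0 d) = Qseries (\<lambda>n. of_nat n ^ 2 * GV_sum GW (- 2) n)"
    "Qseries (\<lambda>d. corr (Phi 1) 0 d) = Qseries (\<lambda>n. of_nat n * GV_sum GW 0 n)"
    by (auto intro!: fps_ext simp: Qseries_nth corr_1 corr_Phi1 simp del: One_nat_def)
  ultimately show ?thesis
    unfolding S_def J_def
    by (simp add: fps_cutoff_7_Qseries GV_sum_def divisors_up_to_6 GV_values[simplified]
        power_int_minus numeral_fps_const)
qed

end
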